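(* Let $G$ be a finite abstract simplicial complex and let $k,m\ge 1$ be integers. Then $$\chi_m(G)=\sum_{\mathbf{x}\in G^k} g_m(\mathbf{x}),\qquad g_m(x_1,\dots,x_k)=\Big(\prod_{j=1}^k\omega(x_j)\Big)\,\chi_m\Big(\bigcap_{j=1}^k U(x_j)\Big).$$
   Context: A finite abstract simplicial complex $G$ is a finite set of non-empty finite sets closed under taking non-empty subsets. For $x\in G$, $\omega(x)=(-1)^{|x|-1}$ and $U(x)=\{y\in G: x\subset y\}$ (inclusion not necessarily strict). For any subset $A\subset G$, the $m$-th characteristic is $\chi_m(A)=\sum\prod_{j=1}^m\omega(x_j)$, the sum over all $(x_1,\dots,x_m)\in A^m$ with $x_1\cap\cdots\cap x_m\in A$. The sum on the right of the claim runs over all $k$-tuples in $G^k$, whether or not they intersect. *)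

theory Defs
  imports Complex_Main "HOL-Library.FuncSet"
begin

(* The empty complex is included, as in the usual definition. *)
definition finite_asc :: "'a set set \<Rightarrow> bool" where
  "finite_asc G \<longleftrightarrow>
     finite G \<and> (\<forall>x\<in>G. finite x \<and> x \<noteq> {}) \<and>
     (\<forall>x\<in>G. \<forall>y. y \<noteq> {} \<and> y \<subseteq> x \<longrightarrow> y \<in> G)"

(* Only used for nonempty finite x, where the truncated subtraction is exact. *)
definition omega :: "'a set \<Rightarrow> int" where
  "omega x = (- 1) ^ (card x - 1)"

definition star :: "'a set set \<Rightarrow> 'a set \<Rightarrow> 'a set set" where
  "star G x = {y \<in> G. x \<subseteq> y}"

(* An n-tuple over A is an extensional function on {1..n}. *)
abbreviation tuples :: "nat \<Rightarrow> 'b set \<Rightarrow> (nat \<Rightarrow> 'b) set" where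
  "tuples n A \<equiv> {1..n} \<rightarrow>\<^sub>E A"

definition characteristic :: "nat \<Rightarrow> 'a set set \<Rightarrow> int" where
  "characteristic m A =
     (\<Sum>x\<in>{x \<in> tuples m A. (\<Inter>j\<in>{1..m}. x j) \<in> A}. \<Prod>j=1..m. omega (x j))"

definition curvature :: "'a set set \<Rightarrow> nat \<Rightarrow> nat \<Rightarrow> (nat \<Rightarrow> 'a set) \<Rightarrow> int" where
  "curvature G m k x =
     (\<Prod>j=1..k. omega (x j)) * characteristic m (\<Inter>j\<in>{1..k}. star G (x j))"

end

theory Submission
  imports Defs
begin

text \<open>The condition on an \<open>m\<close>-tuple in \<open>\<chi>\<^sub>m (\<Inter>\<^sub>j U(x\<^sub>j))\<close> says only that its
  intersection \<open>z\<close> belongs to \<open>G\<close> and contains every \<open>x\<^sub>j\<close>. After exchanging the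
  two sums, each \<open>m\<close>-tuple is therefore weighted by the \<open>k\<close>-th power of the Euler
  characteristic of the full simplex on \<open>z\<close>, which is \<open>1\<close>.\<close>

text \<open>Expanding the product of \<open>1 - 1\<close> over the elements of \<open>z\<close>
  gives the alternating sum over all subsets, which vanishes because \<open>z\<close> is non-empty.
  Removing the empty set, which contributes 1, leaves -1, and \<open>omega\<close> has the opposite
  sign.\<close>

lemma sum_omega_nonempty_subsets:
  assumes "finite z" "z \<noteq> {}"
  shows "(\<Sum>x\<in>Pow z - {{}}. omega x) = 1"
proof -
  have omega_eq: "omega x = - ((-1) ^ card x)" if "x \<in> Pow z - {{}}" for x
  proof -
    have "card x > 0"
      using that assms(1) by (auto simp: card_gt_0_iff intro: finite_subset)
    then show ?thesis
      by (cases "card x") (auto simp: omega_def)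
  qed
  have "(\<Sum>x\<in>Pow z. (-1::int) ^ card x) = 0"
    using assms prod_diff_conv_sum[of z "\<lambda>_. 1 :: int" "\<lambda>_. 1"]
    by (simp add: power_0_left card_eq_0_iff)
  then have "(\<Sum>x\<in>Pow z - {{}}. (-1::int) ^ card x) = -1"
    using assms(1) by (simp add: sum_diff1)
  then show ?thesis
    using omega_eq by (simp add: sum_negf)
qed

theorem mainTheorem15:
  fixes G :: "'a set set" and k m :: nat
  assumes "finite_asc G" and "k \<ge> 1" and "m \<ge> 1"
  shows "characteristic m G = (\<Sum>x\<in>tuples k G. curvature G m k x)"
proof -
  define meet where "meet y = (\<Inter>i\<in>{1..m}. y i)" for y :: "nat \<Rightarrow> 'a set"
  define M where "M = {y \<in> tuples m G. meet y \<in> G}"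
  define w where "w n x = (\<Prod>j=1..n. omega (x j))" for n and x :: "nat \<Rightarrow> 'a set"
  have "finite G"
    using assms(1) unfolding finite_asc_def by blast
  then have fin_tuples: "finite (tuples n G)" for n
    by (simp add: finite_PiE)
  then have fin_M: "finite M"
    by (simp add: M_def)
  have tuples_in_star:
    "{y \<in> tuples m S. meet y \<in> S} =
      {y \<in> M. \<forall>j\<in>{1..k}. x j \<subseteq> meet y}"
    if "S = (\<Inter>j\<in>{1..k}. star G (x j))" for x S
  proof -
    \<comment> \<open>Some index is needed to place \<open>y\<close> in \<open>G\<close>: an
      intersection over no indices would be \<open>UNIV\<close>.\<close>
    have "1 \<in> {1..k}"
      using assms(2) by simp
    then have mem_S: "y \<in> S \<longleftrightarrow> y \<in> G \<and> (\<forall>j\<in>{1..k}. x j \<subseteq> y)" for y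
      unfolding that star_def by blast
    \<comment> \<open>\<open>S\<close> is upward closed in \<open>G\<close> and every entry contains
      the meet, so a meet in \<open>S\<close> forces all entries into \<open>S\<close>.\<close>
    have "y \<in> tuples m S" if "y \<in> tuples m G" "meet y \<in> S" for y
    proof (rule PiE_I)
      fix i assume i: "i \<in> {1..m}"
      then have "meet y \<subseteq> y i"
        by (auto simp: meet_def)
      moreover have "y i \<in> G"
        using that(1) i by (rule PiE_mem)
      ultimately show "y i \<in> S"
        using that(2) unfolding mem_S by (meson order_trans)
    qed (use that(1) in \<open>rule PiE_arb\<close>)
    moreover have "tuples m S \<subseteq> tuples m G"
      by (rule PiE_mono) (use mem_S in blast)
    ultimately have "{y \<in> tuples m S. meet y \<in> S} = {y \<in> tuples m G. meet y \<in> S}"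
      by blast
    then show ?thesis
      by (simp add: mem_S M_def conj_assoc)
  qed
  have weight: "(\<Sum>x | x \<in> tuples k G \<and> (\<forall>j\<in>{1..k}. x j \<subseteq> z). w k x) = 1"
    if "z \<in> G" for z
  proof -
    have z: "finite z" "z \<noteq> {}" and faces: "{x \<in> G. x \<subseteq> z} = Pow z - {{}}"
      using assms(1) that unfolding finite_asc_def by blast+
    \<comment> \<open>The containment constrains each entry separately, so the sum of products
      factors into \<open>k\<close> equal sums over the faces of \<open>z\<close>.\<close>
    have "{x. x \<in> tuples k G \<and> (\<forall>j\<in>{1..k}. x j \<subseteq> z)} = tuples k {x \<in> G. x \<subseteq> z}"
      by (intro set_eqI) (simp add: PiE_iff ball_conj_distrib conj_ac)
    also have "(\<Sum>x\<in>\<dots>. w k x) = (\<Prod>j=1..k. \<Sum>x\<in>Pow z - {{}}. omega x)"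
      using z unfolding faces w_def by (intro prod_sum_PiE[symmetric]) auto
    also have "\<dots> = 1"
      using sum_omega_nonempty_subsets[OF z] by simp
    finally show ?thesis .
  qed
  have "(\<Sum>x\<in>tuples k G. curvature G m k x) =
    (\<Sum>x\<in>tuples k G. \<Sum>y | y \<in> M \<and> (\<forall>j\<in>{1..k}. x j \<subseteq> meet y). w k x * w m y)"
    \<comment> \<open>With \<open>refl\<close>, \<open>S\<close> becomes the intersection of the
      stars of the bound tuple \<open>x\<close>, so the rewriting works under the outer sum.\<close>
    unfolding curvature_def characteristic_def meet_def[symmetric] tuples_in_star[OF refl]
    by (simp add: w_def sum_distrib_left)
  also have "\<dots> =
    (\<Sum>y\<in>M. \<Sum>x | x \<in> tuples k G \<and> (\<forall>j\<in>{1..k}. x j \<subseteq> meet y). w k x * w m y)"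
    by (rule sum.swap_restrict[OF fin_tuples fin_M])
  also have "\<dots> = (\<Sum>y\<in>M. w m y)"
  proof (rule sum.cong[OF refl])
    fix y assume "y \<in> M"
    then have "meet y \<in> G"
      by (simp add: M_def)
    from weight[OF this]
    show "(\<Sum>x | x \<in> tuples k G \<and> (\<forall>j\<in>{1..k}. x j \<subseteq> meet y). w k x * w m y) = w m y"
      by (simp only: sum_distrib_right[symmetric] mult_1_left)
  qed
  also have "\<dots> = characteristic m G"
    by (simp add: characteristic_def M_def meet_def w_def)
  finally show ?thesis ..
qed

end
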